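(* For any integers $a,u$ with $au\neq 0$ and $u^2\neq a^2$, the polynomial $$P_{a,u}(t)=t^8+6(u^2-a^2)\,t^6+\bigl((u^2-a^2)^2-2a^2u^2\bigr)\,t^4-6(u^2-a^2)a^2u^2\,t^2+a^4u^4\in\mathbb{Z}[t]$$ is irreducible in $\mathbb{Z}[t]$. *)

theory Defs
  imports "HOL-Computational_Algebra.Polynomial" "HOL-Computational_Algebra.Polynomial_Factorial"
begin

definition cuboid_poly :: "int \<Rightarrow> int \<Rightarrow> int poly" where
  "cuboid_poly a u =
     monom 1 8
     + monom (6 * (u^2 - a^2)) 6
     + monom ((u^2 - a^2)^2 - 2 * a^2 * u^2) 4
     - monom (6 * (u^2 - a^2) * a^2 * u^2) 2
     + monom (a^4 * u^4) 0"

end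

theory Submission
  imports Defs "HOL-Computational_Algebra.Nth_Powers"
begin

text \<open>Put \<open>b = u\<^sup>2 - a\<^sup>2\<close> and \<open>c = a u\<close>; the hypotheses say that both are nonzero.
  The polynomial is \<open>P(t) = t\<^sup>8 + 6 b t\<^sup>6 + (b\<^sup>2 - 2 c\<^sup>2) t\<^sup>4 - 6 b c\<^sup>2 t\<^sup>2 + c\<^sup>4\<close>, and dividing by \<open>t\<^sup>4\<close>
  turns it into \<open>w\<^sup>2 + 6 b w + b\<^sup>2\<close> with \<open>w = t\<^sup>2 - c\<^sup>2 / t\<^sup>2\<close>. The roots in \<open>w\<close> are
  \<open>- b (3 \<plusminus> 2 \<surd>2)\<close>, so \<open>P\<close> is the product of \<open>x\<^sup>2 + b (3 + 2 \<surd>2) x - c\<^sup>2\<close>, at \<open>x = t\<^sup>2\<close>, and its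
  conjugate over the rationals.

  That quadratic has a negative root \<open>x\<close>, because its constant term is negative; write
  \<open>x = - s\<^sup>2\<close> with \<open>s\<close> real, so that \<open>\<tau> = \<i> s\<close> is a root of \<open>P\<close>. Suppose an integer polynomial of
  degree at most 7 vanishes at \<open>\<tau>\<close>. Its even part is real at \<open>\<tau>\<close> and its odd part is imaginary, so both
  vanish separately (\<open>even_odd_parts_at_imaginary\<close>), and each is an integer relation between
  \<open>1, x, x\<^sup>2, x\<^sup>3\<close>. There is no nontrivial such relation unless \<open>x\<close> lies in \<open>\<rat>(\<surd>2)\<close>
  (\<open>powers_of_root_independent\<close>). Hence \<open>\<tau>\<close> has degree 8 over the rationals, and a monic
  integer polynomial of degree 8 that vanishes at \<open>\<tau>\<close> is irreducible.

  The arithmetic is in showing \<open>x \<notin> \<rat>(\<surd>2)\<close>, that is, that the discriminant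
  \<open>b\<^sup>2 (17 + 12 \<surd>2) + 4 c\<^sup>2\<close> is not a square in \<open>\<rat>(\<surd>2)\<close> (\<open>root_not_in_Q_sqrt_2\<close>). Comparing
  coordinates with \<open>(P + Q \<surd>2)\<^sup>2\<close> and clearing denominators gives the integer system
  \<open>P Q = 6 B\<^sup>2\<close>, \<open>P\<^sup>2 + 2 Q\<^sup>2 = 17 B\<^sup>2 + E\<^sup>2\<close> with \<open>B E \<noteq> 0\<close>. Eliminating \<open>B\<close> yields
  \<open>6 E\<^sup>2 = (2 P - 3 Q) (3 P - 4 Q)\<close>. For coprime positive \<open>P, Q\<close> the first equation leaves four
  square classes. Two of them are impossible modulo 3 and 4, and the other two produce
  nonzero integers for which \<open>x\<^sup>2 + y\<^sup>2\<close> and \<open>x\<^sup>2 + 9 y\<^sup>2\<close> are both squares. Such integers do not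
  exist, by infinite descent (\<open>concordant_one_nine\<close>).\<close>

section \<open>Squares of integers\<close>

lemma coprime_mult_eq_square_nonneg:
  fixes x y z :: int
  assumes "coprime x y" "x * y = z^2" "x \<ge> 0" "y \<ge> 0"
  shows "\<exists>e. x = e^2"
proof -
  have "nat x * nat y = (nat \<bar>z\<bar>)^2"
    using assms(2,3,4) by (simp flip: nat_mult_distrib nat_power_eq)
  then have "is_nth_power 2 (nat x * nat y)" by simp
  have cop: "coprime (nat x) (nat y)"
    using assms(1,3,4) by (simp flip: coprime_int_iff)
  have "is_nth_power 2 (nat x)"
  proof (cases "nat x = 0 \<or> nat y = 0")
    case True
    with cop have "nat x = 0 \<or> nat x = 1" by auto
    then show ?thesis by auto
  next
    case False
    with cop \<open>is_nth_power 2 (nat x * nat y)\<close> show ?thesis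
      using is_nth_power_mult_coprime_natD(1)[of "nat x" "nat y" 2] by simp
  qed
  then obtain n where "nat x = n^2" by (auto simp: is_nth_power_def)
  then have "x = (int n)^2" using assms(3) by (simp flip: of_nat_power)
  then show ?thesis ..
qed

lemma coprime_mult_eq_square:
  fixes x y z :: int
  assumes "coprime x y" "x * y = z^2"
  shows "(\<exists>e f. x = e^2 \<and> y = f^2) \<or> (\<exists>e f. x = -(e^2) \<and> y = -(f^2))"
proof -
  have "x * y \<ge> 0" using assms(2) by simp
  then consider "x \<ge> 0" "y \<ge> 0" | "-x \<ge> 0" "-y \<ge> 0"
    by (auto simp: zero_le_mult_iff)
  then show ?thesis
  proof cases
    case 1
    have "\<exists>e. x = e^2" "\<exists>f. y = f^2"
      using coprime_mult_eq_square_nonneg[of x y z] coprime_mult_eq_square_nonneg[of y x z] assms 1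
      by (auto simp: coprime_commute mult.commute)
    then show ?thesis by blast
  next
    case 2
    have "\<exists>e. -x = e^2" "\<exists>f. -y = f^2"
      using coprime_mult_eq_square_nonneg[of "-x" "-y" z]
        coprime_mult_eq_square_nonneg[of "-y" "-x" z] assms 2
      by (auto simp: coprime_commute mult.commute)
    then obtain e f where "x = -(e^2)" "y = -(f^2)"
      by (metis minus_minus)
    then show ?thesis by blast
  qed
qed

lemma odd_square_mod_8:
  fixes x :: int
  assumes "odd x"
  shows "x^2 mod 8 = 1"
proof -
  have "x mod 8 = 1 \<or> x mod 8 = 3 \<or> x mod 8 = 5 \<or> x mod 8 = 7" using assms by presburger
  then show ?thesis using power_mod[of x 8 2] by auto
qed

lemma square_mod_4:
  fixes x :: int
  shows "x^2 mod 4 = (if even x then 0 else 1)"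
proof -
  have m: "x^2 mod 4 = (x mod 4)^2 mod 4" by (simp add: power_mod)
  have e: "even x \<longleftrightarrow> even (x mod 4)" by (simp add: dvd_mod_iff)
  have "x mod 4 = 0 \<or> x mod 4 = 1 \<or> x mod 4 = 2 \<or> x mod 4 = 3" by presburger
  then show ?thesis unfolding m e by (elim disjE) simp_all
qed

lemma square_mod_3:
  fixes x :: int
  shows "x^2 mod 3 = (if 3 dvd x then 0 else 1)"
proof -
  have m: "x^2 mod 3 = (x mod 3)^2 mod 3" by (simp add: power_mod)
  have "x mod 3 = 0 \<or> x mod 3 = 1 \<or> x mod 3 = 2" by presburger
  then show ?thesis unfolding m dvd_eq_mod_eq_0 by (elim disjE) simp_all
qed

lemma four_dvd_sum_of_squares:
  fixes x y :: int
  assumes "4 dvd x^2 + y^2"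
  shows "even y"
proof -
  have "(x^2 mod 4 + y^2 mod 4) mod 4 = 0" using assms by (simp add: mod_add_eq)
  then show ?thesis unfolding square_mod_4 by (auto split: if_splits)
qed

lemma three_dvd_sum_of_squares:
  fixes x y :: int
  assumes "3 dvd x^2 + y^2"
  shows "3 dvd y"
proof -
  have "(x^2 mod 3 + y^2 mod 3) mod 3 = 0" using assms by (simp add: mod_add_eq)
  then show ?thesis unfolding square_mod_3 by (auto split: if_splits)
qed

lemma coprime_if_coprime_combinations:
  fixes A B p q :: int
  assumes "coprime p q" "p = i * A + j * B" "q = i' * A + j' * B"
  shows "coprime A B"
proof (rule coprimeI)
  fix c assume "c dvd A" "c dvd B"
  then have "c dvd p" "c dvd q" unfolding assms(2,3) by simp_all
  then show "is_unit c" using assms(1) coprime_common_divisor by blast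
qed

text \<open>Without its common factor with \<open>B\<close>, the number \<open>g\<close> is one whose square divides 6, that is, a unit.\<close>

lemma square_dvd_six_times_square:
  fixes g B :: int
  assumes "g^2 dvd 6 * B^2"
  shows "g dvd B"
proof (cases "g = 0")
  case False
  define h where "h = gcd g B"
  have "h \<noteq> 0" using False by (simp add: h_def)
  then obtain g' B' where gB: "g = g' * h" "B = B' * h" "coprime g' B'"
    using gcd_coprime_exists[of g B] unfolding h_def by blast
  have "g'^2 dvd 6 * B'^2"
    using assms \<open>h \<noteq> 0\<close> unfolding gB by (simp add: power_mult_distrib flip: mult.assoc)
  moreover have "coprime (g'^2) (B'^2)" using gB(3) by simp
  ultimately have d: "g'^2 dvd 6" by (simp add: coprime_dvd_mult_left_iff)
  have "\<bar>g'\<bar> \<le> 2"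
  proof (rule ccontr)
    assume "\<not> ?thesis"
    then have "3^2 \<le> \<bar>g'\<bar>^2" by (intro power_mono) auto
    moreover have "g'^2 \<le> 6" using d by (rule zdvd_imp_le) simp
    ultimately show False by simp
  qed
  then have "g' \<in> {-2,-1,0,1,2}" by auto
  with d have "is_unit g'" by auto
  then show ?thesis unfolding gB by (metis mult_dvd_mono dvd_refl unit_imp_dvd)
qed (use assms in auto)

section \<open>Pythagorean triples and equal products\<close>

text \<open>The even leg is halved, and its square is the product of the coprime integers \<open>(\<bar>z\<bar> + x) / 2\<close>
  and \<open>(\<bar>z\<bar> - x) / 2\<close>, which are therefore squares. The legs may be negative: the sign of \<open>y\<close> is
  absorbed into \<open>l\<close>, and that of \<open>x\<close> into the order of \<open>k\<^sup>2\<close> and \<open>l\<^sup>2\<close>.\<close>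

lemma primitive_pythagorean_triple:
  fixes x y z :: int
  assumes "x^2 + y^2 = z^2" "coprime x y" "even y"
  shows "\<exists>k l. coprime k l \<and> odd (k + l) \<and> x = k^2 - l^2 \<and> y = 2 * k * l"
proof -
  have "odd x" using assms(2,3) by (metis coprime_common_divisor odd_one)
  have "even (x^2 + y^2) \<longleftrightarrow> even (z^2)" using assms(1) by simp
  with \<open>odd x\<close> assms(3) have "odd z" by simp
  define w where "w = \<bar>z\<bar>"
  have w: "w \<ge> 0" "odd w" "x^2 + y^2 = w^2" using \<open>odd z\<close> assms(1) by (auto simp: w_def)
  from \<open>odd x\<close> w(2) have "even (w + x)" "even (w - x)" by auto
  then obtain A B where A: "w + x = 2 * A" and B: "w - x = 2 * B" by (meson evenE)
  obtain h where h: "y = 2 * h" using assms(3) by (auto elim: evenE)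
  have x: "x = A - B" and wAB: "w = A + B" using A B by auto
  have AB: "A * B = h^2"
    using w(3) unfolding x wAB h by (simp add: power2_eq_square algebra_simps)
  have "coprime x (h^2)" using assms(2) unfolding h by simp
  then have cop: "coprime A B"
    unfolding x AB[symmetric]
    by (intro coprimeI) (auto dest: coprime_common_divisor intro: dvd_diff dvd_mult2)
  have "A \<ge> 0 \<and> B \<ge> 0"
  proof -
    have "A * B \<ge> 0" "A + B \<ge> 0" using AB w(1) wAB by auto
    then show ?thesis by (auto simp: zero_le_mult_iff)
  qed
  then obtain k l where kl: "A = k^2" "B = l^2"
    using coprime_mult_eq_square_nonneg[OF cop AB] coprime_mult_eq_square_nonneg[of B A h] cop AB
    by (auto simp: coprime_commute mult.commute)
  have "h^2 = (k * l)^2" using AB kl by (simp add: power_mult_distrib)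
  then consider "h = k * l" | "h = k * (-l)" by (auto simp: power2_eq_iff)
  moreover have "coprime k l" using cop kl by simp
  moreover have "odd (k + l)" using w(2) wAB kl by simp
  ultimately show ?thesis
  proof cases
    case 1
    with \<open>coprime k l\<close> \<open>odd (k + l)\<close> show ?thesis
      using x kl h by (intro exI[of _ k] exI[of _ l]) auto
  next
    case 2
    with \<open>coprime k l\<close> \<open>odd (k + l)\<close> show ?thesis
      using x kl h by (intro exI[of _ k] exI[of _ "-l"]) auto
  qed
qed

lemma even_leg_if_odd_leg:
  fixes x y z :: int
  assumes "x^2 + y^2 = z^2" "odd y"
  shows "even x"
proof (rule ccontr)
  assume "\<not> even x"
  have "x^2 mod 8 = 1" "y^2 mod 8 = 1" using odd_square_mod_8 \<open>\<not> even x\<close> assms(2) by auto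
  then have "z^2 mod 4 = 2" using assms(1) by presburger
  with square_mod_4[of z] show False by (simp split: if_splits)
qed

text \<open>Two factorizations of the same number have a common refinement, with \<open>\<alpha> = gcd k r\<close>.\<close>

lemma four_numbers:
  fixes k l r s :: int
  assumes "k * l = r * s" "k \<noteq> 0"
  shows "\<exists>\<alpha> \<beta> \<gamma> \<delta>. k = \<alpha> * \<beta> \<and> l = \<gamma> * \<delta> \<and> r = \<alpha> * \<gamma> \<and> s = \<beta> * \<delta>"
proof -
  define \<alpha> where "\<alpha> = gcd k r"
  have "\<alpha> \<noteq> 0" using assms(2) by (simp add: \<alpha>_def)
  obtain \<beta> \<gamma> where bg: "k = \<beta> * \<alpha>" "r = \<gamma> * \<alpha>" "coprime \<beta> \<gamma>"
    using gcd_coprime_exists[of k r] \<open>\<alpha> \<noteq> 0\<close> unfolding \<alpha>_def by blast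
  have eq: "\<beta> * l = \<gamma> * s" using assms(1) \<open>\<alpha> \<noteq> 0\<close> unfolding bg by simp
  then have "\<gamma> dvd \<beta> * l" by simp
  then have "\<gamma> dvd l" using bg(3)
    using coprime_dvd_mult_right_iff[of \<gamma> \<beta> l] by (simp add: coprime_commute)
  then obtain \<delta> where d: "l = \<gamma> * \<delta>" ..
  show ?thesis
  proof (cases "\<gamma> = 0")
    case True
    (* Here l = 0, so any value of \<delta> is consistent with it, and \<beta> is its own inverse. *)
    with bg(3) have "\<beta> = 1 \<or> \<beta> = -1" by auto
    then have "s = \<beta> * (\<beta> * s)" by auto
    with True bg d show ?thesis
      by (intro exI[of _ \<alpha>] exI[of _ \<beta>] exI[of _ \<gamma>] exI[of _ "\<beta> * s"]) (auto simp: mult.commute)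
  next
    case False
    with eq d have "s = \<beta> * \<delta>" by (simp add: mult.left_commute)
    with bg d show ?thesis by (metis mult.commute)
  qed
qed

section \<open>The forms x^2 + y^2 and x^2 + 9 y^2 are not both squares\<close>

text \<open>This excludes the concordant pairs in which \<open>x\<close> is even and prime to 3: the two Pythagorean triples
  give \<open>x = 2 k l = 2 r s\<close>, \<open>y = k\<^sup>2 - l\<^sup>2\<close> and \<open>3 y = r\<^sup>2 - s\<^sup>2\<close>. The residue of \<open>3 y\<close> modulo 4 forces
  the even one of \<open>r, s\<close> to be \<open>r\<close> when \<open>k\<close> is odd. Then \<open>l\<close> and \<open>r\<close> contain the same power of 2,
  because \<open>k l = r s\<close>, and this is incompatible with the equation modulo 8.\<close>

lemma opposite_parity_factorizations:
  fixes k l r s :: int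
  assumes eq: "k * l = r * s" and odd: "odd k" "even l"
  shows "r^2 - s^2 \<noteq> 3 * (k^2 - l^2)"
proof
  assume E: "r^2 - s^2 = 3 * (k^2 - l^2)"
  obtain l' where l: "l = 2 * l'" using odd(2) by (rule evenE)
  have k8: "k^2 mod 8 = 1" using odd(1) by (rule odd_square_mod_8)
  have "even (r * s)" using eq odd(2) by (metis even_mult_iff)
  moreover have "odd (r^2 - s^2)" unfolding E using odd by simp
  ultimately consider "odd r" "even s" | "even r" "odd s" by auto
  then show False
  proof cases
    case 1
    obtain s' where s: "s = 2 * s'" using 1(2) by (rule evenE)
    have "r^2 mod 8 = 1" using 1(1) by (rule odd_square_mod_8)
    moreover have "r^2 - 4 * s'^2 = 3 * (k^2 - 4 * l'^2)" using E unfolding s l by simp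
    ultimately show False using k8 by presburger
  next
    case 2
    obtain r' where r: "r = 2 * r'" using 2(1) by (rule evenE)
    have "s^2 mod 8 = 1" using 2(2) by (rule odd_square_mod_8)
    moreover have "4 * r'^2 - s^2 = 3 * (k^2 - 4 * l'^2)" using E unfolding r l by simp
    moreover obtain t where "r'^2 + 3 * l'^2 = 2 * t"
    proof -
      have "k * l' = r' * s" using eq unfolding l r by simp
      then have "even l' = even r'" using odd(1) 2(2) by (metis even_mult_iff)
      then have "even (r'^2 + 3 * l'^2)" by simp
      then show ?thesis using that by (rule evenE)
    qed
    ultimately show False using k8 by presburger
  qed
qed

text \<open>The refinement of \<open>r s = k l\<close> turns the second equation into
  \<open>\<gamma>\<^sup>2 (9 \<alpha>\<^sup>2 + \<delta>\<^sup>2) = \<beta>\<^sup>2 (\<alpha>\<^sup>2 + \<delta>\<^sup>2)\<close>. Since \<open>\<beta>\<close> and \<open>\<gamma>\<close> are coprime, the two sums are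
  \<open>g \<beta>\<^sup>2\<close> and \<open>g \<gamma>\<^sup>2\<close>. The common factor \<open>g\<close> divides 8, and parity shows that it is odd, so
  \<open>(\<delta>, \<alpha>)\<close> is again a concordant pair.\<close>

lemma descent_step:
  fixes k l r s :: int
  assumes rs: "r * s = k * l" and eq: "(3 * r)^2 - s^2 = k^2 - l^2"
    and cop: "coprime k l" "coprime r s" and odd: "odd (k + l)" and nz: "k * l \<noteq> 0"
  shows "\<exists>x y z w. coprime x y \<and> x * y \<noteq> 0 \<and> \<bar>x * y\<bar> \<le> \<bar>k * l\<bar>
           \<and> x^2 + y^2 = z^2 \<and> x^2 + 9 * y^2 = w^2"
proof -
  obtain \<alpha> \<beta> \<gamma> \<delta> where f: "k = \<alpha> * \<beta>" "l = \<gamma> * \<delta>" "r = \<alpha> * \<gamma>" "s = \<beta> * \<delta>"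
    using four_numbers[OF rs[symmetric]] nz by auto
  have cad: "coprime \<alpha> \<delta>" using cop(1) f by simp
  have cbg: "coprime \<beta> \<gamma>" using cop(2) f by (simp add: coprime_commute)
  have nz': "\<alpha> \<noteq> 0" "\<beta> \<noteq> 0" "\<gamma> \<noteq> 0" "\<delta> \<noteq> 0" using nz f by auto
  have E: "\<gamma>^2 * (9 * \<alpha>^2 + \<delta>^2) = \<beta>^2 * (\<alpha>^2 + \<delta>^2)"
    using eq unfolding f by (simp add: power2_eq_square algebra_simps)
  then have "\<beta>^2 dvd 9 * \<alpha>^2 + \<delta>^2" using cbg
    using coprime_dvd_mult_right_iff[of "\<beta>^2" "\<gamma>^2"]
    by (metis coprime_power_left_iff coprime_power_right_iff dvd_triv_left)
  then obtain g where g1: "9 * \<alpha>^2 + \<delta>^2 = \<beta>^2 * g" ..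
  with E nz' have g2: "\<alpha>^2 + \<delta>^2 = \<gamma>^2 * g" by (simp add: mult.left_commute)
  have pos: "0 < \<alpha>^2 + \<delta>^2" using nz' by (simp add: sum_power2_gt_zero_iff)
  then have "g > 0" unfolding g2 using nz' by (simp add: zero_less_mult_iff)
  have "odd g"
  proof
    assume "even g"
    then have "even (\<alpha>^2 + \<delta>^2)" unfolding g2 by simp
    then have ev: "even \<alpha> \<longleftrightarrow> even \<delta>" by simp
    have "odd \<alpha>" using ev cad by (metis coprime_common_divisor odd_one)
    then have "odd \<delta>" using ev by simp
    (* With \<alpha> and \<delta> odd both sums are 2 modulo 4, so neither \<beta> nor \<gamma> can be even;
       but exactly one of k and l is even. *)
    have n4: "\<not> 4 dvd \<alpha>^2 + \<delta>^2" "\<not> 4 dvd 9 * \<alpha>^2 + \<delta>^2"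
      using odd_square_mod_8[OF \<open>odd \<alpha>\<close>] odd_square_mod_8[OF \<open>odd \<delta>\<close>] by presburger+
    from odd f \<open>odd \<alpha>\<close> \<open>odd \<delta>\<close> have "even \<beta> \<or> even \<gamma>" by auto
    then have "4 dvd \<beta>^2 \<or> 4 dvd \<gamma>^2"
      by (auto elim!: evenE)
    with n4 show False unfolding g1 g2 by auto
  qed
  have "g dvd 8 * \<alpha>^2" "g dvd 8 * \<delta>^2"
  proof -
    have "8 * \<alpha>^2 = g * (\<beta>^2 - \<gamma>^2)" using g1 g2 by (simp add: algebra_simps)
    then show "g dvd 8 * \<alpha>^2" by simp
    have "8 * \<delta>^2 = g * (9 * \<gamma>^2 - \<beta>^2)" using g1 g2 by (simp add: algebra_simps)
    then show "g dvd 8 * \<delta>^2" by simp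
  qed
  moreover have "coprime g 8"
  proof -
    have "coprime g (2^3)" using \<open>odd g\<close> by (subst coprime_power_right_iff) auto
    then show ?thesis by simp
  qed
  ultimately have "g dvd \<alpha>^2" "g dvd \<delta>^2" by (simp_all add: coprime_dvd_mult_right_iff)
  moreover have "coprime (\<alpha>^2) (\<delta>^2)" using cad by simp
  ultimately have "is_unit g" using coprime_common_divisor by blast
  with \<open>g > 0\<close> have "g = 1" by simp
  have "\<bar>\<delta> * \<alpha>\<bar> * 1 \<le> \<bar>\<delta> * \<alpha>\<bar> * \<bar>\<beta> * \<gamma>\<bar>"
    using nz'
    by (intro mult_left_mono) (auto simp: abs_mult intro: int_one_le_iff_zero_less[THEN iffD2])
  then have "\<bar>\<delta> * \<alpha>\<bar> \<le> \<bar>k * l\<bar>" unfolding f by (simp add: abs_mult mult_ac)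
  then show ?thesis using g1 g2 \<open>g = 1\<close> cad nz'
    by (intro exI[of _ \<delta>] exI[of _ \<alpha>] exI[of _ \<gamma>] exI[of _ \<beta>])
      (auto simp: coprime_commute add.commute)
qed

text \<open>Infinite descent on \<open>\<bar>x y\<bar>\<close>. If 3 divides \<open>x\<close>, then \<open>(y, x / 3)\<close> is a smaller pair. Otherwise
  \<open>(x, y)\<close> and \<open>(x, 3 y)\<close> are the legs of primitive Pythagorean triples. The case of even \<open>x\<close> is
  \<open>opposite_parity_factorizations\<close>. For even \<open>y\<close> the two parametrizations satisfy
  \<open>3 k l = r s\<close>, and removing the factor 3 from \<open>r\<close> or from \<open>s\<close> leads to \<open>descent_step\<close>.\<close>

lemma concordant_one_nine:
  fixes x y z w :: int
  assumes "coprime x y" "x^2 + y^2 = z^2" "x^2 + 9 * y^2 = w^2"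
  shows "x * y = 0"
  using assms
proof (induction "nat \<bar>x * y\<bar>" arbitrary: x y z w rule: less_induct)
  case less
  note cop = less.prems(1) and z = less.prems(2) and w = less.prems(3)
  show ?case
  proof (rule ccontr)
    assume nz: "x * y \<noteq> 0"
    show False
    proof (cases "3 dvd x")
      case True
      then obtain x' where x: "x = 3 * x'" ..
      have "9 * (x'^2 + y^2) = w^2" using w unfolding x by (simp add: power_mult_distrib)
      then have "w^2 = 3 * (3 * (x'^2 + y^2))" by simp
      then have "3 dvd w^2" by (rule dvdI)
      then have "3 dvd w" by (simp add: prime_dvd_power_iff)
      then obtain w' where "w = 3 * w'" ..
      then have 1: "y^2 + x'^2 = w'^2"
        using \<open>9 * (x'^2 + y^2) = w^2\<close> by (simp add: power_mult_distrib)
      have 2: "y^2 + 9 * x'^2 = z^2" using z unfolding x by (simp add: power_mult_distrib)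
      have 3: "coprime y x'" using cop unfolding x by (simp add: coprime_commute)
      have "nat \<bar>y * x'\<bar> < nat \<bar>x * y\<bar>" using nz unfolding x by (simp add: abs_mult)
      from less.hyps[OF this 3 1 2] nz x show False by simp
    next
      case False
      have "coprime 3 x" using False by (intro prime_imp_coprime) auto
      then have cop3: "coprime x (3 * y)" using cop by (simp add: coprime_commute)
      have w': "x^2 + (3 * y)^2 = w^2" using w by (simp add: power_mult_distrib)
      show False
      proof (cases "even y")
        case False
        then have "even x" using even_leg_if_odd_leg z by blast
        obtain k l where kl: "y = k^2 - l^2" "x = 2 * k * l" "odd (k + l)"
          using primitive_pythagorean_triple[of y x z] z cop \<open>even x\<close>
          by (auto simp: add.commute coprime_commute)
        obtain r s where rs: "3 * y = r^2 - s^2" "x = 2 * r * s"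
          using primitive_pythagorean_triple[of "3 * y" x w] w' cop3 \<open>even x\<close>
          by (auto simp: add.commute coprime_commute)
        have E: "r^2 - s^2 = 3 * (k^2 - l^2)" "k * l = r * s" using kl rs by auto
        from kl(3) consider "odd k" "even l" | "odd l" "even k" by auto
        then show False
        proof cases
          case 1
          from opposite_parity_factorizations[OF E(2) 1] E(1) show False by simp
        next
          case 2
          have "l * k = s * r" using E(2) by (simp add: mult.commute)
          from opposite_parity_factorizations[OF this 2] E(1) show False by simp
        qed
      next
        case True
        obtain k l where kl: "x = k^2 - l^2" "y = 2 * k * l" "odd (k + l)" "coprime k l"
          using primitive_pythagorean_triple[OF z cop True] by auto
        obtain r s where rs: "x = r^2 - s^2" "3 * y = 2 * r * s" "coprime r s"
          using primitive_pythagorean_triple[OF w' cop3] True by auto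
        have nz': "k * l \<noteq> 0" using nz kl by auto
        have E: "3 * (k * l) = r * s" using kl rs by auto
        have "\<exists>x y z w. coprime x y \<and> x * y \<noteq> 0 \<and> \<bar>x * y\<bar> \<le> \<bar>k * l\<bar>
                \<and> x^2 + y^2 = z^2 \<and> x^2 + 9 * y^2 = w^2"
        proof -
          have "3 dvd r * s" using E by (metis dvd_triv_left)
          then consider "3 dvd r" | "3 dvd s" by (auto simp: prime_dvd_mult_iff)
          then show ?thesis
          proof cases
            case 1
            then obtain r' where r: "r = 3 * r'" ..
            show ?thesis
              using kl rs nz' E unfolding r by (intro descent_step[of r' s k l]) auto
          next
            case 2
            (* Changing the sign of x exchanges k with l and r with s, which reduces to the first case. *)
            then obtain s' where s: "s = 3 * s'" ..
            have "\<exists>x y z w. coprime x y \<and> x * y \<noteq> 0 \<and> \<bar>x * y\<bar> \<le> \<bar>l * k\<bar>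
                \<and> x^2 + y^2 = z^2 \<and> x^2 + 9 * y^2 = w^2"
              using kl rs nz' E unfolding s
              by (intro descent_step[of s' r l k]) (auto simp: coprime_commute mult.commute)
            then show ?thesis by (simp add: mult.commute)
          qed
        qed
        then obtain x' y' z' w' where n: "coprime x' y'" "x' * y' \<noteq> 0" "\<bar>x' * y'\<bar> \<le> \<bar>k * l\<bar>"
          "x'^2 + y'^2 = z'^2" "x'^2 + 9 * y'^2 = w'^2" by blast
        have "\<bar>x * y\<bar> = \<bar>x\<bar> * 2 * \<bar>k * l\<bar>" unfolding kl(2) by (simp add: abs_mult)
        moreover have "\<bar>x\<bar> \<ge> 1" using nz by auto
        then have "1 * (2 * \<bar>k * l\<bar>) \<le> \<bar>x\<bar> * (2 * \<bar>k * l\<bar>)" by (intro mult_right_mono) auto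
        moreover have "\<bar>k * l\<bar> > 0" using nz' by simp
        ultimately have "nat \<bar>x' * y'\<bar> < nat \<bar>x * y\<bar>" using n(3) by linarith
        from less.hyps[OF this n(1,4,5)] n(2) show False by simp
      qed
    qed
  qed
qed

section \<open>The four square classes\<close>

text \<open>The solutions of \<open>P Q = 6 B\<^sup>2\<close> in coprime positive integers are \<open>P = i m\<^sup>2\<close>, \<open>Q = j n\<^sup>2\<close> with
  \<open>i j = 6\<close>. In each of the four classes \<open>6 E\<^sup>2 = (2 P - 3 Q) (3 P - 4 Q)\<close> becomes an equation
  \<open>E\<^sup>2 = F G\<close> with coprime quadratic forms \<open>F, G\<close> in \<open>m, n\<close>, so that \<open>F\<close> and \<open>G\<close> are both squares or
  both negatives of squares. In the classes \<open>(1, 6)\<close> and \<open>(3, 2)\<close> the negative sign is impossible modulo 4, and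
  the positive sign gives a concordant pair. These two classes contain the points with \<open>E = 0\<close>
  at \<open>P : Q = 3 : 2\<close> and with \<open>B = 0\<close> at \<open>Q = 0\<close>, so a congruence alone cannot exclude them.\<close>

lemma square_class_1_6:
  fixes m n E :: int
  assumes cop: "coprime (m^2) (6 * n^2)" and E: "E^2 = (m^2 - 9 * n^2) * (m^2 - 8 * n^2)"
  shows "n * E = 0"
proof -
  have "odd m" and mn: "coprime (m^2) (n^2)" using cop by auto
  have "coprime (m^2 - 9 * n^2) (m^2 - 8 * n^2)"
    by (rule coprime_if_coprime_combinations[OF mn, of "-8" _ 9 _ "-1" 1]) simp_all
  from coprime_mult_eq_square[OF this E[symmetric]] show ?thesis
  proof (elim disjE exE conjE)
    fix e f assume ef: "m^2 - 9 * n^2 = e^2" "m^2 - 8 * n^2 = f^2"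
    have "coprime (e^2) (n^2)"
      by (rule coprime_if_coprime_combinations[OF mn, of 1 _ 9 _ 0 1]) (use ef in simp_all)
    then have "coprime e n" by simp
    moreover have "e^2 + n^2 = f^2" "e^2 + 9 * n^2 = m^2" using ef by auto
    ultimately have "e * n = 0" by (rule concordant_one_nine)
    then show ?thesis using E ef by auto
  next
    fix e f assume "m^2 - 8 * n^2 = - (f^2)"
    then have "f^2 + m^2 = 4 * (2 * n^2)" by simp
    then have "even m" by (metis dvd_triv_left four_dvd_sum_of_squares)
    with \<open>odd m\<close> show ?thesis ..
  qed
qed

lemma square_class_3_2:
  fixes m n E :: int
  assumes cop: "coprime (3 * m^2) (2 * n^2)" and E: "E^2 = (m^2 - n^2) * (9 * m^2 - 8 * n^2)"
  shows "n * E = 0"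
proof -
  have "odd m" and mn: "coprime (m^2) (n^2)" using cop by auto
  have "coprime (m^2 - n^2) (9 * m^2 - 8 * n^2)"
    by (rule coprime_if_coprime_combinations[OF mn, of "-8" _ 1 _ "-9" 1]) simp_all
  from coprime_mult_eq_square[OF this E[symmetric]] show ?thesis
  proof (elim disjE exE conjE)
    fix e f assume ef: "m^2 - n^2 = e^2" "9 * m^2 - 8 * n^2 = f^2"
    have "coprime (n^2) (e^2)"
      by (rule coprime_if_coprime_combinations[OF mn, of 1 _ 1 _ 1 0]) (use ef in simp_all)
    then have "coprime n e" by simp
    moreover have "n^2 + e^2 = m^2" "n^2 + 9 * e^2 = f^2" using ef by auto
    ultimately have "n * e = 0" by (rule concordant_one_nine)
    then show ?thesis using E ef by auto
  next
    fix e f assume "9 * m^2 - 8 * n^2 = - (f^2)"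
    then have "f^2 + m^2 = 4 * (2 * n^2 - 2 * m^2)" by simp
    then have "even m" by (metis dvd_triv_left four_dvd_sum_of_squares)
    with \<open>odd m\<close> show ?thesis ..
  qed
qed

text \<open>In the classes \<open>(6, 1)\<close> and \<open>(2, 3)\<close> the positive sign is impossible modulo 4 and the negative sign
  modulo 3, because a sum of two squares is divisible by 4 or by 3 only if both squares are even,
  respectively divisible by 3.\<close>

lemma square_class_6_1:
  fixes m n E :: int
  assumes cop: "coprime (6 * m^2) (n^2)"
  shows "E^2 \<noteq> (4 * m^2 - n^2) * (9 * m^2 - 2 * n^2)"
proof
  assume E: "E^2 = (4 * m^2 - n^2) * (9 * m^2 - 2 * n^2)"
  have c6: "coprime 6 (n^2)" and mn: "coprime (m^2) (n^2)"
    using cop by (simp_all only: coprime_mult_left_iff)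
  have "odd n" using c6 by (auto dest: coprime_common_divisor[of _ _ 2])
  have "\<not> 3 dvd n"
  proof
    assume "3 dvd n"
    then have "3 dvd n^2" by (simp add: power2_eq_square)
    then show False using c6 coprime_common_divisor[of 6 "n^2" 3] by simp
  qed
  have "coprime (4 * m^2 - n^2) (9 * m^2 - 2 * n^2)"
    by (rule coprime_if_coprime_combinations[OF mn, of "-2" _ 1 _ "-9" 4]) simp_all
  from coprime_mult_eq_square[OF this E[symmetric]] show False
  proof (elim disjE exE conjE)
    fix e f assume "4 * m^2 - n^2 = e^2"
    then have "e^2 + n^2 = 4 * m^2" by simp
    then have "even n" by (metis dvd_triv_left four_dvd_sum_of_squares)
    with \<open>odd n\<close> show False ..
  next
    fix e f assume "9 * m^2 - 2 * n^2 = - (f^2)"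
    then have "f^2 + n^2 = 3 * (n^2 - 3 * m^2)" by simp
    then have "3 dvd n" by (metis dvd_triv_left three_dvd_sum_of_squares)
    with \<open>\<not> 3 dvd n\<close> show False ..
  qed
qed

lemma square_class_2_3:
  fixes m n E :: int
  assumes cop: "coprime (2 * m^2) (3 * n^2)"
  shows "E^2 \<noteq> (4 * m^2 - 9 * n^2) * (m^2 - 2 * n^2)"
proof
  assume E: "E^2 = (4 * m^2 - 9 * n^2) * (m^2 - 2 * n^2)"
  have "coprime 2 (n^2)" "coprime (m^2) 3" and mn: "coprime (m^2) (n^2)"
    using cop by (simp_all only: coprime_mult_left_iff coprime_mult_right_iff)
  then have "odd n" by simp
  have "\<not> 3 dvd m"
  proof
    assume "3 dvd m"
    then have "3 dvd m^2" by (simp add: power2_eq_square)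
    then show False using \<open>coprime (m^2) 3\<close> coprime_common_divisor[of "m^2" 3 3] by simp
  qed
  have "coprime (4 * m^2 - 9 * n^2) (m^2 - 2 * n^2)"
    by (rule coprime_if_coprime_combinations[OF mn, of "-2" _ 9 _ "-1" 4]) simp_all
  from coprime_mult_eq_square[OF this E[symmetric]] show False
  proof (elim disjE exE conjE)
    fix e f assume "4 * m^2 - 9 * n^2 = e^2"
    then have "e^2 + n^2 = 4 * (m^2 - 2 * n^2)" by simp
    then have "even n" by (metis dvd_triv_left four_dvd_sum_of_squares)
    with \<open>odd n\<close> show False ..
  next
    fix e f assume "4 * m^2 - 9 * n^2 = - (e^2)"
    then have "e^2 + m^2 = 3 * (3 * n^2 - m^2)" by simp
    then have "3 dvd m" by (metis dvd_triv_left three_dvd_sum_of_squares)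
    with \<open>\<not> 3 dvd m\<close> show False ..
  qed
qed

lemma square_factors_times_six:
  fixes P Q B :: int
  assumes "coprime P Q" "P * Q = 6 * B^2" "P > 0" "Q > 0"
  shows "\<exists>m n. B^2 = (m * n)^2 \<and>
    (P = m^2 \<and> Q = 6 * n^2 \<or> P = 3 * m^2 \<and> Q = 2 * n^2 \<or>
     P = 6 * m^2 \<and> Q = n^2 \<or> P = 2 * m^2 \<and> Q = 3 * n^2)"
proof -
  have split: "\<exists>m n. B^2 = (m * n)^2 \<and> P = i * m^2 \<and> Q = j * n^2"
    if ij: "i * j = 6" "i > 0" "j > 0" and d: "i dvd P" "j dvd Q" for i j
  proof -
    from d obtain p q where pq: "P = i * p" "Q = j * q" by (elim dvdE)
    have "6 * (p * q) = (i * j) * (p * q)" using ij by simp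
    also have "\<dots> = 6 * B^2" using assms(2) unfolding pq by (simp add: mult_ac)
    finally have prod: "p * q = B^2" by simp
    have cop: "coprime p q" using assms(1) unfolding pq by simp
    have pos: "p \<ge> 0" "q \<ge> 0" using assms(3,4) ij unfolding pq by (auto simp: zero_less_mult_iff)
    obtain m where m: "p = m^2"
      using coprime_mult_eq_square_nonneg[OF cop prod pos] by blast
    obtain n where n: "q = n^2"
      using coprime_mult_eq_square_nonneg[of q p B] cop prod pos
      by (auto simp: coprime_commute mult.commute)
    show ?thesis using prod pq m n
      by (intro exI[of _ m] exI[of _ n]) (auto simp: power_mult_distrib)
  qed
  have "2 dvd P * Q" "3 dvd P * Q" unfolding assms(2) by auto
  then have two: "2 dvd P \<or> 2 dvd Q" and three: "3 dvd P \<or> 3 dvd Q"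
    by (auto simp: prime_dvd_mult_iff)
  have six: "6 dvd x" if "2 dvd x" "3 dvd x" for x :: int using that by presburger
  from two three show ?thesis
    using split[of 1 6] split[of 3 2] split[of 6 1] split[of 2 3] six by auto
qed

text \<open>The system says that \<open>(P + Q \<surd>2)\<^sup>2 = B\<^sup>2 (17 + 12 \<surd>2) + E\<^sup>2\<close>. It is homogeneous, so \<open>P\<close> and \<open>Q\<close> may be
  divided by their greatest common divisor, which then divides \<open>B\<close> because 6 is squarefree,
  and hence \<open>E\<close>.\<close>

lemma quadric_intersection_trivial:
  fixes P Q B E :: int
  assumes PQ: "P * Q = 6 * B^2" and sum: "P^2 + 2 * Q^2 = 17 * B^2 + E^2"
  shows "B * E = 0"
proof (rule ccontr)
  assume nz: "B * E \<noteq> 0"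
  have main: False
    if cop: "coprime P Q" and pos: "P > 0" "Q > 0" and PQ: "P * Q = 6 * B^2"
      and sum: "P^2 + 2 * Q^2 = 17 * B^2 + E^2" and nz: "B * E \<noteq> 0" for P Q B E :: int
  proof -
    have E: "6 * E^2 = (2 * P - 3 * Q) * (3 * P - 4 * Q)"
    proof -
      have "6 * E^2 = 6 * P^2 + 12 * Q^2 - 17 * (6 * B^2)" using sum by simp
      also have "\<dots> = (2 * P - 3 * Q) * (3 * P - 4 * Q)"
        unfolding PQ[symmetric] by (simp add: power2_eq_square algebra_simps)
      finally show ?thesis .
    qed
    obtain m n where B: "B^2 = (m * n)^2" and cl:
      "P = m^2 \<and> Q = 6 * n^2 \<or> P = 3 * m^2 \<and> Q = 2 * n^2 \<or>
       P = 6 * m^2 \<and> Q = n^2 \<or> P = 2 * m^2 \<and> Q = 3 * n^2"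
      using square_factors_times_six[OF cop PQ pos] by blast
    have "m * n \<noteq> 0" using B nz by auto
    from cl show False
    proof (elim disjE conjE)
      assume c: "P = m^2" "Q = 6 * n^2"
      then have "E^2 = (m^2 - 9 * n^2) * (m^2 - 8 * n^2)" using E by (simp add: algebra_simps)
      with square_class_1_6 cop c have "n * E = 0" by blast
      with nz \<open>m * n \<noteq> 0\<close> show False by auto
    next
      assume c: "P = 3 * m^2" "Q = 2 * n^2"
      then have "E^2 = (m^2 - n^2) * (9 * m^2 - 8 * n^2)" using E by (simp add: algebra_simps)
      with square_class_3_2 cop c have "n * E = 0" by blast
      with nz \<open>m * n \<noteq> 0\<close> show False by auto
    next
      assume c: "P = 6 * m^2" "Q = n^2"
      then have "E^2 = (4 * m^2 - n^2) * (9 * m^2 - 2 * n^2)" using E by (simp add: algebra_simps)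
      with square_class_6_1 cop c show False by blast
    next
      assume c: "P = 2 * m^2" "Q = 3 * n^2"
      then have "E^2 = (4 * m^2 - 9 * n^2) * (m^2 - 2 * n^2)" using E by (simp add: algebra_simps)
      with square_class_2_3 cop c show False by blast
    qed
  qed
  have "P * Q > 0" unfolding PQ using nz by auto
  define g where "g = gcd P Q"
  have "g \<noteq> 0" using \<open>P * Q > 0\<close> by (auto simp: g_def)
  then obtain P' Q' where P': "P = P' * g" "Q = Q' * g" "coprime P' Q'"
    using gcd_coprime_exists[of P Q] unfolding g_def by blast
  have "P * Q = g^2 * (P' * Q')" unfolding P' by (simp add: power2_eq_square)
  then have "6 * B^2 = g^2 * (P' * Q')" unfolding PQ .
  then have "g dvd B" by (simp add: square_dvd_six_times_square)
  then obtain B' where B': "B = g * B'" ..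
  have "E^2 = g^2 * (P'^2 + 2 * Q'^2 - 17 * B'^2)"
    using sum unfolding P' B' by (simp add: power_mult_distrib algebra_simps)
  then have "g^2 dvd E^2" by simp
  then have "g dvd E" by simp
  then obtain E' where E': "E = g * E'" ..
  have g2: "g^2 \<noteq> 0" using \<open>g \<noteq> 0\<close> by simp
  have "g^2 * (P' * Q') = g^2 * (6 * B'^2)"
    using \<open>6 * B^2 = g^2 * (P' * Q')\<close> unfolding B' by (auto simp: power_mult_distrib)
  then have 1: "P' * Q' = 6 * B'^2" using g2 mult_left_cancel by blast
  have "g^2 * (P'^2 + 2 * Q'^2) = g^2 * (17 * B'^2 + E'^2)"
    using sum unfolding P' B' E' by (simp add: power_mult_distrib algebra_simps)
  then have 2: "P'^2 + 2 * Q'^2 = 17 * B'^2 + E'^2" using g2 mult_left_cancel by blast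
  have 3: "B' * E' \<noteq> 0" using nz unfolding B' E' by simp
  have "P' * Q' > 0" unfolding 1 using 3 by auto
  then consider "P' > 0" "Q' > 0" | "-P' > 0" "-Q' > 0" by (auto simp: zero_less_mult_iff)
  then show False
  proof cases
    case 1
    with main[of P' Q' B' E'] P'(3) \<open>P' * Q' = 6 * B'^2\<close> 2 3 show False by blast
  next
    case 2
    with main[of "-P'" "-Q'" B' E'] P'(3) \<open>P' * Q' = 6 * B'^2\<close> 3
      \<open>P'^2 + 2 * Q'^2 = 17 * B'^2 + E'^2\<close> show False by simp
  qed
qed

section \<open>Independence of the powers of the negative root\<close>

lemma sqrt_2_coords_eq_0:
  fixes i j :: int
  assumes "real_of_int i + real_of_int j * sqrt 2 = 0"
  shows "i = 0 \<and> j = 0"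
proof -
  have "real_of_int i = - (real_of_int j * sqrt 2)" using assms by simp
  then have "(real_of_int i)^2 = 2 * (real_of_int j)^2" by (simp add: power_mult_distrib)
  then have "real_of_int (i^2) = real_of_int (2 * j^2)" by simp
  then have ij: "i^2 = 2 * j^2" by (simp only: of_int_eq_iff)
  have "j = 0"
  proof (rule ccontr)
    assume "j \<noteq> 0"
    have "j^2 dvd i^2" unfolding ij by simp
    then obtain k where "i = j * k" by auto
    with ij \<open>j \<noteq> 0\<close> have "k^2 = 2" by (simp add: power_mult_distrib)
    then show False using square_mod_4[of k] by (simp split: if_splits)
  qed
  with ij show ?thesis by simp
qed

text \<open>The relation would put \<open>x\<close>, and with it the square root \<open>2 x + b (3 + 2 \<surd>2)\<close> of the discriminant
  \<open>b\<^sup>2 (17 + 12 \<surd>2) + 4 c\<^sup>2\<close>, into \<open>\<rat>(\<surd>2)\<close>. Multiplying the relation by the conjugate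
  \<open>n\<^sub>0 - n\<^sub>1 \<surd>2\<close> makes the coefficient of that square root the integer norm \<open>N\<close>, and squaring gives the
  system of \<open>quadric_intersection_trivial\<close> with \<open>B = N b\<close> and \<open>E = 2 N c\<close>. So \<open>N = 0\<close>,
  and the irrationality of \<open>\<surd>2\<close> does the rest.\<close>

lemma root_not_in_Q_sqrt_2:
  fixes b c m0 m1 n0 n1 :: int and x :: real
  assumes nz: "b \<noteq> 0" "c \<noteq> 0"
    and x: "x^2 + b * (3 + 2 * sqrt 2) * x = c^2"
    and rel: "(m0 + m1 * sqrt 2) + (n0 + n1 * sqrt 2) * x = 0"
  shows "m0 = 0 \<and> m1 = 0 \<and> n0 = 0 \<and> n1 = 0"
proof -
  define e where "e = 3 + 2 * sqrt (2::real)"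
  define N where "N = n0^2 - 2 * n1^2"
  (* By the relation, (n0 + n1 \<surd>2) (2 x + b e) has the coordinates w0 and w1 with respect to 1 and \<surd>2;
     P and Q are the coordinates after multiplication by n0 - n1 \<surd>2. *)
  define w0 where "w0 = - 2 * m0 + b * (3 * n0 + 4 * n1)"
  define w1 where "w1 = - 2 * m1 + b * (2 * n0 + 3 * n1)"
  define P where "P = n0 * w0 - 2 * n1 * w1"
  define Q where "Q = n0 * w1 - n1 * w0"
  have w: "(n0 + n1 * sqrt 2) * (2 * x + b * e) = w0 + w1 * sqrt 2"
  proof -
    have "(n0 + n1 * sqrt 2) * (2 * x + b * e) =
        2 * ((n0 + n1 * sqrt 2) * x) + b * ((n0 + n1 * sqrt 2) * e)"
      by (simp add: algebra_simps)
    also have "(n0 + n1 * sqrt 2) * x = - (m0 + m1 * sqrt 2)" using rel by simp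
    also have "(n0 + n1 * sqrt 2) * e = (3 * n0 + 4 * n1) + (2 * n0 + 3 * n1) * sqrt 2"
      unfolding e_def by (simp add: algebra_simps)
    finally show ?thesis unfolding w0_def w1_def by (simp add: algebra_simps)
  qed
  have "N * (2 * x + b * e) = (n0 - n1 * sqrt 2) * ((n0 + n1 * sqrt 2) * (2 * x + b * e))"
    unfolding N_def by (simp add: algebra_simps power2_eq_square)
  also have "\<dots> = P + Q * sqrt 2"
    unfolding w P_def Q_def by (simp add: algebra_simps)
  finally have PQ: "N * (2 * x + b * e) = P + Q * sqrt 2" .
  have "(2 * x + b * e)^2 = 4 * (x^2 + b * e * x) + b^2 * e^2"
    by (simp add: algebra_simps power2_eq_square)
  also have "x^2 + b * e * x = c^2" using x unfolding e_def .
  also have "e^2 = 17 + 12 * sqrt 2" unfolding e_def by (simp add: algebra_simps power2_eq_square)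
  finally have "(2 * x + b * e)^2 = 4 * c^2 + b^2 * (17 + 12 * sqrt 2)" by simp
  then have "(P + Q * sqrt 2)^2 = N^2 * (4 * c^2 + b^2 * (17 + 12 * sqrt 2))"
    unfolding PQ[symmetric] power_mult_distrib by simp
  also have "\<dots> = N^2 * (17 * b^2 + 4 * c^2) + (12 * N^2 * b^2) * sqrt 2"
    by (simp add: distrib_left)
  also have "(P + Q * sqrt 2)^2 = (P^2 + 2 * Q^2) + (2 * P * Q) * sqrt 2"
    by (simp add: power2_sum power_mult_distrib)
  finally have "real_of_int (P^2 + 2 * Q^2 - N^2 * (17 * b^2 + 4 * c^2)) +
      real_of_int (2 * P * Q - 12 * N^2 * b^2) * sqrt 2 = 0"
    by (simp add: left_diff_distrib)
  from sqrt_2_coords_eq_0[OF this]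
  have "P^2 + 2 * Q^2 = N^2 * (17 * b^2 + 4 * c^2)" "2 * P * Q = 12 * N^2 * b^2" by simp_all
  then have "P * Q = 6 * (N * b)^2" "P^2 + 2 * Q^2 = 17 * (N * b)^2 + (2 * N * c)^2"
    by (simp_all add: power_mult_distrib distrib_left)
  from quadric_intersection_trivial[OF this] nz have "N = 0" by auto
  have "(n0 + n1 * sqrt 2) * (n0 - n1 * sqrt 2) = N"
    unfolding N_def by (simp add: algebra_simps power2_eq_square)
  with \<open>N = 0\<close> have "n0 + n1 * sqrt 2 = 0 \<or> real_of_int n0 + real_of_int (- n1) * sqrt 2 = 0"
    by auto
  then have n: "n0 = 0 \<and> n1 = 0"
    using sqrt_2_coords_eq_0[of n0 n1] sqrt_2_coords_eq_0[of n0 "-n1"] by auto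
  with rel have "m0 + m1 * sqrt 2 = 0" by simp
  with n sqrt_2_coords_eq_0 show ?thesis by blast
qed

text \<open>Reducing \<open>x\<^sup>2\<close> and \<open>x\<^sup>3\<close> by the quadratic equation turns the relation into one of the form
  \<open>(m\<^sub>0 + m\<^sub>1 \<surd>2) + (n\<^sub>0 + n\<^sub>1 \<surd>2) x = 0\<close>, whose four coordinates vanish. The irrational
  coordinates give \<open>p\<^sub>3 = 0\<close> and then \<open>p\<^sub>2 = 0\<close>.\<close>

lemma powers_of_root_independent:
  fixes b c p0 p1 p2 p3 :: int and x :: real
  assumes nz: "b \<noteq> 0" "c \<noteq> 0"
    and x: "x^2 + b * (3 + 2 * sqrt 2) * x = c^2"
    and rel: "p0 + p1 * x + p2 * x^2 + p3 * x^3 = 0"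
  shows "p0 = 0 \<and> p1 = 0 \<and> p2 = 0 \<and> p3 = 0"
proof -
  define m0 m1 n0 n1 where
    "m0 = p0 + p2 * c^2 - 3 * b * c^2 * p3" and "m1 = - 2 * b * c^2 * p3" and
    "n0 = p1 - 3 * b * p2 + p3 * (17 * b^2 + c^2)" and "n1 = - 2 * b * p2 + 12 * b^2 * p3"
  have "(m0 + m1 * sqrt 2) + (n0 + n1 * sqrt 2) * x = 0"
  proof -
    have x2: "x^2 = c^2 - b * (3 + 2 * sqrt 2) * x" using x by simp
    have "x^3 = x * x^2" by (simp add: power3_eq_cube power2_eq_square)
    also have "\<dots> = x * (c^2 - b * (3 + 2 * sqrt 2) * x)" by (simp only: x2)
    also have "\<dots> = c^2 * x - b * (3 + 2 * sqrt 2) * x^2"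
      by (simp add: algebra_simps power2_eq_square)
    also have "\<dots> = c^2 * x - b * (3 + 2 * sqrt 2) * (c^2 - b * (3 + 2 * sqrt 2) * x)"
      by (simp only: x2)
    also have "\<dots> = c^2 * x - b * (3 + 2 * sqrt 2) * c^2 + b^2 * (17 + 12 * sqrt 2) * x"
      by (simp add: algebra_simps power2_eq_square)
    finally have x3: "x^3 = c^2 * x - b * (3 + 2 * sqrt 2) * c^2 + b^2 * (17 + 12 * sqrt 2) * x" .
    have "p0 + p1 * x + p2 * x^2 + p3 * x^3 = p0 + p1 * x + p2 * (c^2 - b * (3 + 2 * sqrt 2) * x)
        + p3 * (c^2 * x - b * (3 + 2 * sqrt 2) * c^2 + b^2 * (17 + 12 * sqrt 2) * x)"
      by (simp only: x2 x3)
    also have "\<dots> = (m0 + m1 * sqrt 2) + (n0 + n1 * sqrt 2) * x"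
      unfolding m0_def m1_def n0_def n1_def by (simp add: algebra_simps)
    finally have "(m0 + m1 * sqrt 2) + (n0 + n1 * sqrt 2) * x = p0 + p1 * x + p2 * x^2 + p3 * x^3" ..
    then show ?thesis using rel by simp
  qed
  from root_not_in_Q_sqrt_2[OF nz x this]
  have *: "m0 = 0" "m1 = 0" "n0 = 0" "n1 = 0" by auto
  from *(2) nz have "p3 = 0" by (simp add: m1_def)
  with *(4) nz have "p2 = 0" by (simp add: n1_def)
  with * \<open>p3 = 0\<close> show ?thesis by (simp add: m0_def n0_def)
qed

section \<open>Irreducibility\<close>

lemma map_poly_of_int_add:
  "map_poly of_int (p + q) = (map_poly of_int p + map_poly of_int q :: 'a::ring_char_0 poly)"
  by (rule poly_eqI) (simp add: coeff_map_poly)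

lemma map_poly_of_int_diff:
  "map_poly of_int (p - q) = (map_poly of_int p - map_poly of_int q :: 'a::ring_char_0 poly)"
  by (rule poly_eqI) (simp add: coeff_map_poly)

lemma map_poly_of_int_mult:
  "map_poly of_int (p * q) =
    (map_poly of_int p * map_poly of_int q :: 'a::{comm_ring_1,ring_char_0} poly)"
  by (rule poly_eqI) (simp add: coeff_map_poly coeff_mult)

text \<open>At \<open>\<tau> = \<i> s\<close> the even powers are the real numbers \<open>(- s\<^sup>2)\<^sup>i\<close> and the odd powers are \<open>\<tau>\<close> times these, so
  the real and the imaginary part of \<open>h(\<tau>)\<close> are the even and the odd part of \<open>h\<close>.\<close>

lemma even_odd_parts_at_imaginary:
  fixes h :: "int poly" and s :: real
  assumes s: "s \<noteq> 0" and deg: "degree h \<le> 7"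
    and root: "poly (map_poly of_int h) (Complex 0 s) = 0"
  shows "coeff h 0 + coeff h 2 * (-(s^2)) + coeff h 4 * (-(s^2))^2 + coeff h 6 * (-(s^2))^3 = 0"
    and "coeff h 1 + coeff h 3 * (-(s^2)) + coeff h 5 * (-(s^2))^2 + coeff h 7 * (-(s^2))^3 = 0"
proof -
  define \<tau> where "\<tau> = Complex 0 s"
  have t2: "\<tau>^2 = of_real (-(s^2))"
    by (simp add: \<tau>_def power2_eq_square complex_eq_iff)
  have pow: "\<tau>^(2 * i) = of_real ((-(s^2))^i)" "\<tau>^(2 * i + 1) = \<tau> * of_real ((-(s^2))^i)" for i
    unfolding power_add power_mult t2 by simp_all
  have "0 = (\<Sum>i\<le>degree h. of_int (coeff h i) * \<tau>^i)"
    using root unfolding \<tau>_def[symmetric] by (simp add: poly_altdef degree_map_poly coeff_map_poly)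
  also have "\<dots> = (\<Sum>i<8. of_int (coeff h i) * \<tau>^i)"
    using deg by (intro sum.mono_neutral_left) (auto simp: coeff_eq_0)
  also have "\<dots> = (\<Sum>i<4. of_int (coeff h (2 * i)) * \<tau>^(2 * i))
      + (\<Sum>i<4. of_int (coeff h (2 * i + 1)) * \<tau>^(2 * i + 1))"
    by (simp add: eval_nat_numeral)
  also have "\<dots> = of_real (\<Sum>i<4. of_int (coeff h (2 * i)) * (-(s^2))^i)
      + \<tau> * of_real (\<Sum>i<4. of_int (coeff h (2 * i + 1)) * (-(s^2))^i)"
    unfolding pow of_real_sum sum_distrib_left by (simp add: mult_ac)
  finally have "(\<Sum>i<4. of_int (coeff h (2 * i)) * (-(s^2))^i) = (0::real)"
    "s * (\<Sum>i<4. of_int (coeff h (2 * i + 1)) * (-(s^2))^i) = 0"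
    by (simp_all add: complex_eq_iff \<tau>_def)
  with s show "coeff h 0 + coeff h 2 * (-(s^2)) + coeff h 4 * (-(s^2))^2 + coeff h 6 * (-(s^2))^3 = 0"
    "coeff h 1 + coeff h 3 * (-(s^2)) + coeff h 5 * (-(s^2))^2 + coeff h 7 * (-(s^2))^3 = 0"
    by (simp_all add: eval_nat_numeral)
qed

lemma annihilator_degree_ge_8:
  fixes b c :: int and s :: real and h :: "int poly"
  assumes nz: "b \<noteq> 0" "c \<noteq> 0" and s: "s \<noteq> 0"
    and x: "(-(s^2))^2 + b * (3 + 2 * sqrt 2) * (-(s^2)) = c^2"
    and root: "poly (map_poly of_int h) (Complex 0 s) = 0" and "h \<noteq> 0"
  shows "degree h \<ge> 8"
proof (rule ccontr)
  assume "\<not> degree h \<ge> 8"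
  then have deg: "degree h \<le> 7" by simp
  note eo = even_odd_parts_at_imaginary[OF s deg root]
  have "coeff h i = 0" if "i < 8" for i
  proof -
    from that have "i \<in> {0,1,2,3,4,5,6,7}" by auto
    then show ?thesis
      using powers_of_root_independent[OF nz x eo(1)] powers_of_root_independent[OF nz x eo(2)]
      by auto
  qed
  moreover have "coeff h i = 0" if "i \<ge> 8" for i
    using deg that by (intro coeff_eq_0) simp
  ultimately have "h = 0" by (intro poly_eqI) (metis coeff_0 not_le)
  with \<open>h \<noteq> 0\<close> show False ..
qed

text \<open>The roots of \<open>x\<^sup>2 + b x - c\<^sup>2\<close> have opposite signs because their product is \<open>- c\<^sup>2\<close>; the negative one
  is \<open>- s\<^sup>2\<close>.\<close>

lemma ex_imaginary_parameter:
  fixes b c :: real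
  assumes "c \<noteq> 0"
  shows "\<exists>s::real. s \<noteq> 0 \<and> (-(s^2))^2 + b * (-(s^2)) = c^2"
proof -
  define d where "d = sqrt (b^2 + 4 * c^2)"
  have d2: "d^2 = b^2 + 4 * c^2" by (simp add: d_def)
  have "\<bar>b\<bar> < d" unfolding d_def using assms by (intro real_less_rsqrt) simp
  then have pos: "(b + d) / 2 > 0" by (simp add: abs_less_iff)
  define s where "s = sqrt ((b + d) / 2)"
  have s2: "s^2 = (b + d) / 2" using pos by (simp add: s_def)
  have "(-(s^2))^2 + b * (-(s^2)) = c^2"
    unfolding s2 using d2 by (simp add: power2_eq_square field_simps)
  moreover have "s \<noteq> 0" using pos by (simp add: s_def)
  ultimately show ?thesis by blast
qed

lemma irreducible_octic:
  fixes b c :: int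
  assumes nz: "b \<noteq> 0" "c \<noteq> 0"
  defines "P \<equiv> monom 1 8 + monom (6 * b) 6 + monom (b^2 - 2 * c^2) 4
    - monom (6 * b * c^2) 2 + monom (c^4) 0"
  shows "irreducible P"
proof -
  obtain s :: real where s: "s \<noteq> 0"
    and x: "(-(s^2))^2 + b * (3 + 2 * sqrt 2) * (-(s^2)) = c^2"
    using ex_imaginary_parameter[of "real_of_int c" "b * (3 + 2 * sqrt 2)"] nz by auto
  define ev where "ev h = poly (map_poly of_int h) (Complex 0 s)" for h
  have "coeff P 8 = 1" unfolding P_def by simp
  moreover have "degree P \<le> 8" unfolding P_def by (intro degree_le) auto
  ultimately have degP: "degree P = 8" by (intro antisym le_degree) auto
  have lead: "lead_coeff P = 1" using degP \<open>coeff P 8 = 1\<close> by simp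
  have "ev P = 0"
  proof -
    define y where "y = -(s^2)"
    have t2: "(Complex 0 s)^2 = of_real y"
      by (simp add: y_def power2_eq_square complex_eq_iff)
    have "(Complex 0 s)^(2 * i) = of_real (y^i)" for i
      unfolding power_mult t2 by simp
    from this[of 1] this[of 2] this[of 3] this[of 4]
    have "ev P = of_real (y^4 + 6 * b * y^3 + (b^2 - 2 * c^2) * y^2 - 6 * b * c^2 * y + c^4)"
      unfolding ev_def P_def
      by (simp add: map_poly_of_int_add map_poly_of_int_diff map_poly_monom poly_monom)
    (* The numbers 3 + 2 \<surd>2 and 3 - 2 \<surd>2 have the sum 6 and the product 1. *)
    also have "y^4 + 6 * b * y^3 + (b^2 - 2 * c^2) * y^2 - 6 * b * c^2 * y + c^4 =
        (y^2 + b * (3 + 2 * sqrt 2) * y - c^2) * (y^2 + b * (3 - 2 * sqrt 2) * y - c^2)"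
      by (simp add: algebra_simps power2_eq_square power3_eq_cube power4_eq_xxxx)
    also have "\<dots> = 0" using x unfolding y_def by simp
    finally show ?thesis by simp
  qed
  (* The factor that vanishes at \<tau> takes the whole degree, and leading coefficients multiply to 1. *)
  have unit: "is_unit g" if fg: "f * g = P" and f: "ev f = 0" for f g
  proof -
    have "f \<noteq> 0" "g \<noteq> 0" using fg degP by auto
    have "degree f \<ge> 8"
      using annihilator_degree_ge_8[OF nz s x] f \<open>f \<noteq> 0\<close> unfolding ev_def by blast
    moreover have "degree f + degree g = 8"
      using degP \<open>f \<noteq> 0\<close> \<open>g \<noteq> 0\<close> unfolding fg[symmetric] by (simp add: degree_mult_eq)
    ultimately have "degree g = 0" by simp
    then obtain d where d: "g = [:d:]" by (rule degree_eq_zeroE)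
    have "lead_coeff f * d = 1" using lead unfolding fg[symmetric] lead_coeff_mult d by simp
    then have "is_unit d" by (metis dvd_triv_right)
    then show ?thesis unfolding d by (simp add: is_unit_const_poly_iff)
  qed
  show "irreducible P"
  proof (rule irreducibleI)
    show "P \<noteq> 0" using degP by auto
    show "\<not> is_unit P" using degP by (auto simp: is_unit_poly_iff)
    fix f g assume fg: "P = f * g"
    have "ev f * ev g = 0"
      using \<open>ev P = 0\<close> unfolding fg ev_def map_poly_of_int_mult by simp
    then show "is_unit f \<or> is_unit g"
      using unit[of f g] unit[of g f] fg by (auto simp: mult.commute)
  qed
qed

theorem theorem1:
  fixes a u :: int
  assumes "a * u \<noteq> 0" and "u^2 \<noteq> a^2"
  shows "irreducible (cuboid_poly a u)"
proof -
  have "cuboid_poly a u = monom 1 8 + monom (6 * (u^2 - a^2)) 6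
      + monom ((u^2 - a^2)^2 - 2 * (a * u)^2) 4 - monom (6 * (u^2 - a^2) * (a * u)^2) 2
      + monom ((a * u)^4) 0"
    unfolding cuboid_poly_def by (simp add: power_mult_distrib mult_ac)
  then show ?thesis using irreducible_octic[of "u^2 - a^2" "a * u"] assms by simp
qed

end
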